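(* Let $(M,\rho,T_M)$ be a representation of a Rota-Baxter $3$-Lie algebra $(\mathfrak g,[\cdot,\cdot,\cdot],T)$ of weight $\lambda$. Two cohomologous $2$-cocycles $(\psi_1,\chi_1)$ and $(\psi_2,\chi_2)$ of $(\mathfrak g,[\cdot,\cdot,\cdot],T)$ with coefficients in $(M,\rho,T_M)$ give rise to isomorphic abelian extensions $(\mathfrak g\oplus M,[\cdot,\cdot,\cdot]_{\psi_1},T_{\chi_1})$ and $(\mathfrak g\oplus M,[\cdot,\cdot,\cdot]_{\psi_2},T_{\chi_2})$ of $(\mathfrak g,[\cdot,\cdot,\cdot],T)$ by $(M,0,T_M)$.
   Context: Let $k$ be a field of characteristic $0$; vector spaces are over $k$; $\lambda\in k$. A $3$-Lie algebra is a vector space $\mathfrak g$ with a linear map $[\cdot,\cdot,\cdot]:\wedge^3\mathfrak g\to\mathfrak g$ such that $[x_1,x_2,[x_3,x_4,x_5]]=[[x_1,x_2,x_3],x_4,x_5]+[x_3,[x_1,x_2,x_4],x_5]+[x_3,x_4,[x_1,x_2,x_5]]$. A representation on $M$ is a linear map $\rho:\wedge^2\mathfrak g\to\mathfrak{gl}(M)$ with $\rho(x_1,x_2)\rho(x_3,x_4)=\rho([x_1,x_2,x_3],x_4)+\rho(x_3,[x_1,x_2,x_4])+\rho(x_3,x_4)\rho(x_1,x_2)$ and $\rho(x_1,[x_2,x_3,x_4])=\rho(x_3,x_4)\rho(x_1,x_2)-\rho(x_2,x_4)\rho(x_1,x_3)+\rho(x_2,x_3)\rho(x_1,x_4)$.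 A Rota-Baxter $3$-Lie algebra of weight $\lambda$ is a $3$-Lie algebra with a linear map $T:\mathfrak g\to\mathfrak g$ such that $[T(x),T(y),T(z)]=T([x,y,z]_T)$, where $[x,y,z]_T:=[T(x),T(y),z]+[T(x),y,T(z)]+[x,T(y),T(z)]+\lambda[T(x),y,z]+\lambda[x,T(y),z]+\lambda[x,y,T(z)]+\lambda^2[x,y,z]$. Morphisms are $3$-Lie algebra homomorphisms commuting with the operators. A representation is a triple $(M,\rho,T_M)$ with $(M,\rho)$ a representation of the $3$-Lie algebra and $T_M\in\mathrm{End}(M)$ satisfying $\rho(T(x),T(y))T_M(m)=T_M\big(\rho(T(x),T(y))m+\rho(T(x),y)T_M(m)+\rho(x,T(y))T_M(m)+\lambda\rho(T(x),y)m+\lambda\rho(x,T(y))m+\lambda\rho(x,y)T_M(m)+\lambda^2\rho(x,y)m\big)$. A vector space $M$ with $T_M\in\mathrm{End}(M)$ is regarded as a Rota-Baxter $3$-Lie algebra $(M,0,T_M)$ with zero bracket. An abelian extension of $(\mathfrak g,[\cdot,\cdot,\cdot],T)$ by $(M,0,T_M)$ is a short exact sequence $0\to M\xrightarrow{i}\hat{\mathfrak g}\xrightarrow{p}\mathfrak g\to0$ of morphisms of Rota-Baxter $3$-Lie algebras of weight $\lambda$ such that $[u,i(m),i(n)]_{\hat{\mathfrak g}}=0$ for all $u\in\hat{\mathfrak g}$, $m,n\in M$. Two abelian extensions $(\hat{\mathfrak g}_1,i_1,p_1)$, $(\hat{\mathfrak g}_2,i_2,p_2)$ are isomorphic if there is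 an isomorphism $\zeta:\hat{\mathfrak g}_1\to\hat{\mathfrak g}_2$ of Rota-Baxter $3$-Lie algebras with $\zeta\circ i_1=i_2$ and $p_2\circ\zeta=p_1$. Given a $2$-cocycle $(\psi,\chi)$ (defined below), it is known that $\mathfrak g\oplus M$ with $[x+m,y+n,z+q]_\psi=[x,y,z]+\rho(x,y)q+\rho(z,x)n+\rho(y,z)m+\psi(x,y,z)$ and $T_\chi(x+m)=T(x)+\chi(x)+T_M(m)$ is a Rota-Baxter $3$-Lie algebra of weight $\lambda$ and, with the canonical inclusion of $M$ and projection to $\mathfrak g$, an abelian extension of $\mathfrak g$ by $M$. Cocycles and coboundaries. Put $\rho_T(x,y)m=\rho(T(x),T(y))m-T_M\big(\rho(T(x),y)m+\rho(x,T(y))m+\lambda\rho(x,y)m\big)$. The $1$-cochains are $\mathrm{Hom}(\mathfrak g,M)\oplus M$ and the $2$-cochains are $\mathrm{Hom}(\wedge^3\mathfrak g,M)\oplus\mathrm{Hom}(\mathfrak g,M)$. The differentials are $d^1(f,a)=(\delta^1f,-\partial^0a-\Phi^1f)$ with $\partial^0=0$, and $d^2(f,g)=(\delta^2f,-\partial^1g-\Phi^2f)$, where $(\delta^1f)(x,y,z)=-f([x,y,z])+\rho(x,y)f(z)+\rho(y,z)f(x)+\rho(z,x)f(y)$; $\Phi^1f=f\circ T-T_M\circ f$; $(\delta^2f)(x_1,\dots,x_5)=-f([x_1,x_2,x_3],x_4,x_5)-f(x_3,[x_1,x_2,x_4],x_5)-f(x_3,x_4,[x_1,x_2,x_5])+f(x_1,x_2,[x_3,x_4,x_5])+\rho(x_1,x_2)f(x_3,x_4,x_5)-\rho(x_3,x_4)f(x_1,x_2,x_5)-\rho(x_4,x_5)f(x_1,x_2,x_3)-\rho(x_5,x_3)f(x_1,x_2,x_4)$;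 $(\partial^1g)(x,y,z)=-g([x,y,z]_T)+\rho_T(x,y)g(z)+\rho_T(y,z)g(x)+\rho_T(z,x)g(y)$; $(\Phi^2f)(x,y,z)=f(T(x),T(y),T(z))-T_M\big(f(T(x),T(y),z)+f(T(x),y,T(z))+f(x,T(y),T(z))+\lambda f(T(x),y,z)+\lambda f(x,T(y),z)+\lambda f(x,y,T(z))+\lambda^2f(x,y,z)\big)$. A $2$-cocycle is an element of $\ker d^2$; two $2$-cocycles are cohomologous if their difference lies in $\operatorname{im}d^1$. *)

theory Defs
  imports
    "HOL-Analysis.Product_Vector"
    "HOL-Library.Function_Algebras"
begin

text \<open>
  A linear map out of an exterior square or cube is represented by the corresponding curried
  multilinear map that vanishes whenever two of its arguments are equal.
\<close>

definition alternating_bilinear ::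
  "('k::field \<Rightarrow> 'a::ab_group_add \<Rightarrow> 'a) \<Rightarrow> ('k \<Rightarrow> 'b::ab_group_add \<Rightarrow> 'b) \<Rightarrow> ('a \<Rightarrow> 'a \<Rightarrow> 'b) \<Rightarrow> bool"
  where "alternating_bilinear s1 s2 f \<longleftrightarrow>
    (\<forall>y. Vector_Spaces.linear s1 s2 (\<lambda>x. f x y)) \<and>
    (\<forall>x. Vector_Spaces.linear s1 s2 (\<lambda>y. f x y)) \<and>
    (\<forall>x. f x x = 0)"

definition alternating_trilinear ::
  "('k::field \<Rightarrow> 'a::ab_group_add \<Rightarrow> 'a) \<Rightarrow> ('k \<Rightarrow> 'b::ab_group_add \<Rightarrow> 'b) \<Rightarrow> ('a \<Rightarrow> 'a \<Rightarrow> 'a \<Rightarrow> 'b) \<Rightarrow> bool"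
  where "alternating_trilinear s1 s2 f \<longleftrightarrow>
    (\<forall>y z. Vector_Spaces.linear s1 s2 (\<lambda>x. f x y z)) \<and>
    (\<forall>x z. Vector_Spaces.linear s1 s2 (\<lambda>y. f x y z)) \<and>
    (\<forall>x y. Vector_Spaces.linear s1 s2 (\<lambda>z. f x y z)) \<and>
    (\<forall>x y. f x x y = 0 \<and> f x y x = 0 \<and> f x y y = 0)"


section \<open>Rota-Baxter 3-Lie algebras and their representations\<close>

locale three_lie_algebra = vector_space scaleG
  for scaleG :: "'k::field_char_0 \<Rightarrow> 'g::ab_group_add \<Rightarrow> 'g" +
  fixes br :: "'g \<Rightarrow> 'g \<Rightarrow> 'g \<Rightarrow> 'g"
  assumes br_alternating: "alternating_trilinear scaleG scaleG br"
    and fundamental_identity: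
      "br x1 x2 (br x3 x4 x5) =
         br (br x1 x2 x3) x4 x5 + br x3 (br x1 x2 x4) x5 + br x3 x4 (br x1 x2 x5)"

definition rb_bracket ::
  "('k \<Rightarrow> 'g::ab_group_add \<Rightarrow> 'g) \<Rightarrow> ('g \<Rightarrow> 'g \<Rightarrow> 'g \<Rightarrow> 'g) \<Rightarrow> 'k::field_char_0 \<Rightarrow> ('g \<Rightarrow> 'g)
    \<Rightarrow> 'g \<Rightarrow> 'g \<Rightarrow> 'g \<Rightarrow> 'g"
  where "rb_bracket scaleG br lam T x y z =
    br (T x) (T y) z + br (T x) y (T z) + br x (T y) (T z)
    + scaleG lam (br (T x) y z) + scaleG lam (br x (T y) z) + scaleG lam (br x y (T z))
    + scaleG (lam\<^sup>2) (br x y z)"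

locale rb_three_lie_algebra = three_lie_algebra scaleG br
  for scaleG :: "'k::field_char_0 \<Rightarrow> 'g::ab_group_add \<Rightarrow> 'g" and br +
  fixes lam :: 'k and T :: "'g \<Rightarrow> 'g"
  assumes T_linear: "Vector_Spaces.linear scaleG scaleG T"
    and rota_baxter: "br (T x) (T y) (T z) = T (rb_bracket scaleG br lam T x y z)"

definition rb_morphism ::
  "'k::field_char_0
    \<Rightarrow> ('k \<Rightarrow> 'a::ab_group_add \<Rightarrow> 'a) \<Rightarrow> ('a \<Rightarrow> 'a \<Rightarrow> 'a \<Rightarrow> 'a) \<Rightarrow> ('a \<Rightarrow> 'a)
    \<Rightarrow> ('k \<Rightarrow> 'b::ab_group_add \<Rightarrow> 'b) \<Rightarrow> ('b \<Rightarrow> 'b \<Rightarrow> 'b \<Rightarrow> 'b) \<Rightarrow> ('b \<Rightarrow> 'b)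
    \<Rightarrow> ('a \<Rightarrow> 'b) \<Rightarrow> bool"
  where "rb_morphism lam sA brA TA sB brB TB f \<longleftrightarrow>
    rb_three_lie_algebra sA brA lam TA \<and> rb_three_lie_algebra sB brB lam TB \<and>
    Vector_Spaces.linear sA sB f \<and>
    (\<forall>x y z. f (brA x y z) = brB (f x) (f y) (f z)) \<and>
    f \<circ> TA = TB \<circ> f"

locale three_lie_representation =
  three_lie_algebra scaleG br + M: vector_space scaleM
  for scaleG :: "'k::field_char_0 \<Rightarrow> 'g::ab_group_add \<Rightarrow> 'g" and br
    and scaleM :: "'k \<Rightarrow> 'm::ab_group_add \<Rightarrow> 'm" +
  fixes rho :: "'g \<Rightarrow> 'g \<Rightarrow> 'm \<Rightarrow> 'm"
  assumes rho_linear: "Vector_Spaces.linear scaleM scaleM (rho x y)"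
    and rho_alternating: "alternating_bilinear scaleG scaleM (\<lambda>x y. rho x y m)"
    and rho_rho:
      "rho x1 x2 (rho x3 x4 m) =
         rho (br x1 x2 x3) x4 m + rho x3 (br x1 x2 x4) m + rho x3 x4 (rho x1 x2 m)"
    and rho_br:
      "rho x1 (br x2 x3 x4) m =
         rho x3 x4 (rho x1 x2 m) - rho x2 x4 (rho x1 x3 m) + rho x2 x3 (rho x1 x4 m)"

locale rb_representation =
  rb_three_lie_algebra scaleG br lam T + three_lie_representation scaleG br scaleM rho
  for scaleG :: "'k::field_char_0 \<Rightarrow> 'g::ab_group_add \<Rightarrow> 'g" and br lam T
    and scaleM :: "'k \<Rightarrow> 'm::ab_group_add \<Rightarrow> 'm" and rho +
  fixes TM :: "'m \<Rightarrow> 'm"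
  assumes TM_linear: "Vector_Spaces.linear scaleM scaleM TM"
    and rho_rota_baxter:
      "rho (T x) (T y) (TM m) =
         TM (rho (T x) (T y) m + rho (T x) y (TM m) + rho x (T y) (TM m)
           + scaleM lam (rho (T x) y m) + scaleM lam (rho x (T y) m)
           + scaleM lam (rho x y (TM m)) + scaleM (lam\<^sup>2) (rho x y m))"


section \<open>Cochains and differentials in degrees 1 and 2\<close>

definition delta1 ::
  "('g \<Rightarrow> 'g \<Rightarrow> 'g \<Rightarrow> 'g) \<Rightarrow> ('g \<Rightarrow> 'g \<Rightarrow> 'm \<Rightarrow> 'm) \<Rightarrow> ('g \<Rightarrow> 'm)
    \<Rightarrow> 'g \<Rightarrow> 'g \<Rightarrow> 'g \<Rightarrow> 'm::ab_group_add"
  where "delta1 br rho f = (\<lambda>x y z.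
    - f (br x y z) + rho x y (f z) + rho y z (f x) + rho z x (f y))"

definition delta2 ::
  "('g \<Rightarrow> 'g \<Rightarrow> 'g \<Rightarrow> 'g) \<Rightarrow> ('g \<Rightarrow> 'g \<Rightarrow> 'm \<Rightarrow> 'm) \<Rightarrow> ('g \<Rightarrow> 'g \<Rightarrow> 'g \<Rightarrow> 'm)
    \<Rightarrow> 'g \<Rightarrow> 'g \<Rightarrow> 'g \<Rightarrow> 'g \<Rightarrow> 'g \<Rightarrow> 'm::ab_group_add"
  where "delta2 br rho f = (\<lambda>x1 x2 x3 x4 x5.
    - f (br x1 x2 x3) x4 x5 - f x3 (br x1 x2 x4) x5 - f x3 x4 (br x1 x2 x5)
    + f x1 x2 (br x3 x4 x5)
    + rho x1 x2 (f x3 x4 x5) - rho x3 x4 (f x1 x2 x5)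
    - rho x4 x5 (f x1 x2 x3) - rho x5 x3 (f x1 x2 x4))"

definition rho_T ::
  "'k \<Rightarrow> ('g \<Rightarrow> 'g) \<Rightarrow> ('k \<Rightarrow> 'm::ab_group_add \<Rightarrow> 'm) \<Rightarrow> ('g \<Rightarrow> 'g \<Rightarrow> 'm \<Rightarrow> 'm) \<Rightarrow> ('m \<Rightarrow> 'm)
    \<Rightarrow> 'g \<Rightarrow> 'g \<Rightarrow> 'm \<Rightarrow> 'm"
  where "rho_T lam T scaleM rho TM x y m =
    rho (T x) (T y) m - TM (rho (T x) y m + rho x (T y) m + scaleM lam (rho x y m))"

definition partial0 :: "'m \<Rightarrow> 'g \<Rightarrow> 'm::ab_group_add"
  where "partial0 a = 0"

definition partial1 ::
  "('k \<Rightarrow> 'g::ab_group_add \<Rightarrow> 'g) \<Rightarrow> ('g \<Rightarrow> 'g \<Rightarrow> 'g \<Rightarrow> 'g) \<Rightarrow> 'k::field_char_0 \<Rightarrow> ('g \<Rightarrow> 'g)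
    \<Rightarrow> ('k \<Rightarrow> 'm::ab_group_add \<Rightarrow> 'm) \<Rightarrow> ('g \<Rightarrow> 'g \<Rightarrow> 'm \<Rightarrow> 'm) \<Rightarrow> ('m \<Rightarrow> 'm)
    \<Rightarrow> ('g \<Rightarrow> 'm) \<Rightarrow> 'g \<Rightarrow> 'g \<Rightarrow> 'g \<Rightarrow> 'm"
  where "partial1 scaleG br lam T scaleM rho TM g = (\<lambda>x y z.
    - g (rb_bracket scaleG br lam T x y z)
    + rho_T lam T scaleM rho TM x y (g z)
    + rho_T lam T scaleM rho TM y z (g x)
    + rho_T lam T scaleM rho TM z x (g y))"

definition Phi1 :: "('g \<Rightarrow> 'g) \<Rightarrow> ('m \<Rightarrow> 'm) \<Rightarrow> ('g \<Rightarrow> 'm) \<Rightarrow> 'g \<Rightarrow> 'm::ab_group_add"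
  where "Phi1 T TM f = (f \<circ> T) - (TM \<circ> f)"

definition Phi2 ::
  "'k::field_char_0 \<Rightarrow> ('g \<Rightarrow> 'g) \<Rightarrow> ('k \<Rightarrow> 'm::ab_group_add \<Rightarrow> 'm) \<Rightarrow> ('m \<Rightarrow> 'm)
    \<Rightarrow> ('g \<Rightarrow> 'g \<Rightarrow> 'g \<Rightarrow> 'm) \<Rightarrow> 'g \<Rightarrow> 'g \<Rightarrow> 'g \<Rightarrow> 'm"
  where "Phi2 lam T scaleM TM f = (\<lambda>x y z.
    f (T x) (T y) (T z)
    - TM (f (T x) (T y) z + f (T x) y (T z) + f x (T y) (T z)
        + scaleM lam (f (T x) y z) + scaleM lam (f x (T y) z) + scaleM lam (f x y (T z))
        + scaleM (lam\<^sup>2) (f x y z)))"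

definition cochains1 ::
  "('k::field_char_0 \<Rightarrow> 'g::ab_group_add \<Rightarrow> 'g) \<Rightarrow> ('k \<Rightarrow> 'm::ab_group_add \<Rightarrow> 'm)
    \<Rightarrow> (('g \<Rightarrow> 'm) \<times> 'm) set"
  where "cochains1 scaleG scaleM = Collect (Vector_Spaces.linear scaleG scaleM) \<times> UNIV"

definition cochains2 ::
  "('k::field_char_0 \<Rightarrow> 'g::ab_group_add \<Rightarrow> 'g) \<Rightarrow> ('k \<Rightarrow> 'm::ab_group_add \<Rightarrow> 'm)
    \<Rightarrow> (('g \<Rightarrow> 'g \<Rightarrow> 'g \<Rightarrow> 'm) \<times> ('g \<Rightarrow> 'm)) set"
  where "cochains2 scaleG scaleM =
    Collect (alternating_trilinear scaleG scaleM) \<times> Collect (Vector_Spaces.linear scaleG scaleM)"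

definition d1 ::
  "('g \<Rightarrow> 'g \<Rightarrow> 'g \<Rightarrow> 'g) \<Rightarrow> ('g \<Rightarrow> 'g) \<Rightarrow> ('g \<Rightarrow> 'g \<Rightarrow> 'm \<Rightarrow> 'm) \<Rightarrow> ('m \<Rightarrow> 'm)
    \<Rightarrow> ('g \<Rightarrow> 'm) \<times> 'm \<Rightarrow> ('g \<Rightarrow> 'g \<Rightarrow> 'g \<Rightarrow> 'm) \<times> ('g \<Rightarrow> 'm::ab_group_add)"
  where "d1 br T rho TM = (\<lambda>(f, a). (delta1 br rho f, - partial0 a - Phi1 T TM f))"

definition d2 ::
  "('k \<Rightarrow> 'g::ab_group_add \<Rightarrow> 'g) \<Rightarrow> ('g \<Rightarrow> 'g \<Rightarrow> 'g \<Rightarrow> 'g) \<Rightarrow> 'k::field_char_0 \<Rightarrow> ('g \<Rightarrow> 'g)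
    \<Rightarrow> ('k \<Rightarrow> 'm::ab_group_add \<Rightarrow> 'm) \<Rightarrow> ('g \<Rightarrow> 'g \<Rightarrow> 'm \<Rightarrow> 'm) \<Rightarrow> ('m \<Rightarrow> 'm)
    \<Rightarrow> ('g \<Rightarrow> 'g \<Rightarrow> 'g \<Rightarrow> 'm) \<times> ('g \<Rightarrow> 'm)
    \<Rightarrow> ('g \<Rightarrow> 'g \<Rightarrow> 'g \<Rightarrow> 'g \<Rightarrow> 'g \<Rightarrow> 'm) \<times> ('g \<Rightarrow> 'g \<Rightarrow> 'g \<Rightarrow> 'm)"
  where "d2 scaleG br lam T scaleM rho TM = (\<lambda>(f, g).
    (delta2 br rho f,
     - partial1 scaleG br lam T scaleM rho TM g - Phi2 lam T scaleM TM f))"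

definition cocycles2 ::
  "('k \<Rightarrow> 'g::ab_group_add \<Rightarrow> 'g) \<Rightarrow> ('g \<Rightarrow> 'g \<Rightarrow> 'g \<Rightarrow> 'g) \<Rightarrow> 'k::field_char_0 \<Rightarrow> ('g \<Rightarrow> 'g)
    \<Rightarrow> ('k \<Rightarrow> 'm::ab_group_add \<Rightarrow> 'm) \<Rightarrow> ('g \<Rightarrow> 'g \<Rightarrow> 'm \<Rightarrow> 'm) \<Rightarrow> ('m \<Rightarrow> 'm)
    \<Rightarrow> (('g \<Rightarrow> 'g \<Rightarrow> 'g \<Rightarrow> 'm) \<times> ('g \<Rightarrow> 'm)) set"
  where "cocycles2 scaleG br lam T scaleM rho TM =
    {c \<in> cochains2 scaleG scaleM. d2 scaleG br lam T scaleM rho TM c = 0}"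

definition cohomologous2 ::
  "('k::field_char_0 \<Rightarrow> 'g::ab_group_add \<Rightarrow> 'g) \<Rightarrow> ('g \<Rightarrow> 'g \<Rightarrow> 'g \<Rightarrow> 'g) \<Rightarrow> ('g \<Rightarrow> 'g)
    \<Rightarrow> ('k \<Rightarrow> 'm::ab_group_add \<Rightarrow> 'm) \<Rightarrow> ('g \<Rightarrow> 'g \<Rightarrow> 'm \<Rightarrow> 'm) \<Rightarrow> ('m \<Rightarrow> 'm)
    \<Rightarrow> ('g \<Rightarrow> 'g \<Rightarrow> 'g \<Rightarrow> 'm) \<times> ('g \<Rightarrow> 'm) \<Rightarrow> ('g \<Rightarrow> 'g \<Rightarrow> 'g \<Rightarrow> 'm) \<times> ('g \<Rightarrow> 'm) \<Rightarrow> bool"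
  where "cohomologous2 scaleG br T scaleM rho TM c c' \<longleftrightarrow>
    c - c' \<in> d1 br T rho TM ` cochains1 scaleG scaleM"


section \<open>Abelian extensions\<close>

definition abelian_extension ::
  "'k::field_char_0
    \<Rightarrow> ('k \<Rightarrow> 'g::ab_group_add \<Rightarrow> 'g) \<Rightarrow> ('g \<Rightarrow> 'g \<Rightarrow> 'g \<Rightarrow> 'g) \<Rightarrow> ('g \<Rightarrow> 'g)
    \<Rightarrow> ('k \<Rightarrow> 'm::ab_group_add \<Rightarrow> 'm) \<Rightarrow> ('m \<Rightarrow> 'm)
    \<Rightarrow> ('k \<Rightarrow> 'e::ab_group_add \<Rightarrow> 'e) \<Rightarrow> ('e \<Rightarrow> 'e \<Rightarrow> 'e \<Rightarrow> 'e) \<Rightarrow> ('e \<Rightarrow> 'e)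
    \<Rightarrow> ('m \<Rightarrow> 'e) \<Rightarrow> ('e \<Rightarrow> 'g) \<Rightarrow> bool"
  where "abelian_extension lam scaleG br T scaleM TM scaleE brE TE i p \<longleftrightarrow>
    rb_morphism lam scaleM (\<lambda>_ _ _. 0) TM scaleE brE TE i \<and>
    rb_morphism lam scaleE brE TE scaleG br T p \<and>
    inj i \<and> range i = {u. p u = 0} \<and> surj p \<and>
    (\<forall>u m n. brE u (i m) (i n) = 0)"

definition isomorphic_extensions ::
  "'k::field_char_0
    \<Rightarrow> ('k \<Rightarrow> 'a::ab_group_add \<Rightarrow> 'a) \<Rightarrow> ('a \<Rightarrow> 'a \<Rightarrow> 'a \<Rightarrow> 'a) \<Rightarrow> ('a \<Rightarrow> 'a)
    \<Rightarrow> ('m \<Rightarrow> 'a) \<Rightarrow> ('a \<Rightarrow> 'g)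
    \<Rightarrow> ('k \<Rightarrow> 'b::ab_group_add \<Rightarrow> 'b) \<Rightarrow> ('b \<Rightarrow> 'b \<Rightarrow> 'b \<Rightarrow> 'b) \<Rightarrow> ('b \<Rightarrow> 'b)
    \<Rightarrow> ('m \<Rightarrow> 'b) \<Rightarrow> ('b \<Rightarrow> 'g) \<Rightarrow> bool"
  where "isomorphic_extensions lam scale1 br1 T1 i1 p1 scale2 br2 T2 i2 p2 \<longleftrightarrow>
    (\<exists>zeta. rb_morphism lam scale1 br1 T1 scale2 br2 T2 zeta \<and> bij zeta \<and>
      zeta \<circ> i1 = i2 \<and> p2 \<circ> zeta = p1)"

text \<open>
  The direct sum of \<open>\<gg>\<close> and \<open>M\<close> is the product type; its scalar multiplication is
  \<^const>\<open>module_prod.scale\<close>, with \<open>\<lambda>m. (0, m)\<close> and \<^const>\<open>fst\<close> as canonical inclusion and projection.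
\<close>

definition bracket_psi ::
  "('g \<Rightarrow> 'g \<Rightarrow> 'g \<Rightarrow> 'g) \<Rightarrow> ('g \<Rightarrow> 'g \<Rightarrow> 'm \<Rightarrow> 'm) \<Rightarrow> ('g \<Rightarrow> 'g \<Rightarrow> 'g \<Rightarrow> 'm)
    \<Rightarrow> 'g \<times> 'm \<Rightarrow> 'g \<times> 'm \<Rightarrow> 'g \<times> 'm \<Rightarrow> 'g \<times> 'm::ab_group_add"
  where "bracket_psi br rho psi = (\<lambda>(x, m) (y, n) (z, q).
    (br x y z, rho x y q + rho z x n + rho y z m + psi x y z))"

definition T_chi :: "('g \<Rightarrow> 'g) \<Rightarrow> ('m \<Rightarrow> 'm) \<Rightarrow> ('g \<Rightarrow> 'm) \<Rightarrow> 'g \<times> 'm \<Rightarrow> 'g \<times> 'm::ab_group_add"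
  where "T_chi T TM chi = (\<lambda>(x, m). (T x, chi x + TM m))"

end

theory Submission
  imports Defs
begin

text \<open>
  If \<open>(\<psi>\<^sub>1, \<chi>\<^sub>1) - (\<psi>\<^sub>2, \<chi>\<^sub>2) = d\<^sup>1(f, a)\<close>, then \<open>(x, m) \<mapsto> (x, m + f x)\<close> is an isomorphism from the
  first extension to the second: compatibility with the brackets is \<open>\<psi>\<^sub>1 - \<psi>\<^sub>2 = \<delta>\<^sup>1 f\<close>, and
  compatibility with the operators is \<open>\<chi>\<^sub>1 - \<chi>\<^sub>2 = - \<Phi>\<^sup>1 f\<close>; the component \<open>a\<close> plays no role because
  \<open>\<partial>\<^sup>0 = 0\<close>. That \<open>\<gg> \<oplus> M\<close> is a Rota-Baxter 3-Lie algebra at all splits into the axioms of a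
  representation for the terms linear in \<open>M\<close> and the two components of the cocycle condition for
  the remaining terms.
\<close>

text \<open>Supplies the source of the inclusion: \<open>rb_morphism\<close> asks that
  \<open>M\<close> itself be a Rota-Baxter 3-Lie algebra. Both sides of the operator identity vanish
  since \<open>S 0 = 0\<close>.\<close>

lemma rb_three_lie_algebra_zero_bracket:
  assumes "Vector_Spaces.linear s s S"
  shows "rb_three_lie_algebra s (\<lambda>_ _ _. 0) lam S"
proof -
  interpret S: Vector_Spaces.linear s s S by fact
  have "Vector_Spaces.linear s s (\<lambda>_. 0)"
    by (simp add: Vector_Spaces.linear_iff S.vs1.vector_space_axioms)
  then have "alternating_trilinear s s (\<lambda>_ _ _. 0)"
    by (simp add: alternating_trilinear_def)
  then show ?thesis
    by unfold_locales
      (simp_all add: rb_bracket_def S.zero assms)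
qed

section \<open>Pointwise rules for the bracket, the operators and the representation\<close>

context rb_three_lie_algebra
begin

lemma T_add: "T (x + y) = T x + T y"
  and T_scale: "T (scaleG c x) = scaleG c (T x)"
  using T_linear by (simp_all add: Vector_Spaces.linear_iff)

lemma br_add:
  "br (x + x') y z = br x y z + br x' y z"
  "br x (y + y') z = br x y z + br x y' z"
  "br x y (z + z') = br x y z + br x y z'"
  and br_scale:
  "br (scaleG c x) y z = scaleG c (br x y z)"
  "br x (scaleG c y) z = scaleG c (br x y z)"
  "br x y (scaleG c z) = scaleG c (br x y z)"
  and br_alt: "br x x y = 0" "br x y x = 0" "br x y y = 0"
  using br_alternating by (simp_all add: alternating_trilinear_def Vector_Spaces.linear_iff)

end

context rb_representation
begin

lemma TM_add: "TM (m + n) = TM m + TM n"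
  and TM_scale: "TM (scaleM c m) = scaleM c (TM m)"
  using TM_linear by (simp_all add: Vector_Spaces.linear_iff)

lemma rho_add:
  "rho x y (m + n) = rho x y m + rho x y n"
  "rho (x + x') y m = rho x y m + rho x' y m"
  "rho x (y + y') m = rho x y m + rho x y' m"
  and rho_scale:
  "rho x y (scaleM c m) = scaleM c (rho x y m)"
  "rho (scaleG c x) y m = scaleM c (rho x y m)"
  "rho x (scaleG c y) m = scaleM c (rho x y m)"
  and rho_alt: "rho x x m = 0"
  using rho_linear rho_alternating
  by (simp_all add: alternating_bilinear_def Vector_Spaces.linear_iff)

lemma rho_zero: "rho x y 0 = 0"
  using rho_add(1)[of x y 0 0] by simp

lemma rho_uminus: "rho x y (- m) = - rho x y m"
  using rho_add(1)[of x y m "- m"] by (simp add: rho_zero eq_neg_iff_add_eq_0 add.commute)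

text \<open>Polarisation: expand \<open>rho (x + y) (x + y) m = 0\<close>.\<close>

lemma rho_cancel: "rho x y m + rho y x m = 0"
proof -
  have "rho (x + y) (x + y) m = rho x y m + rho y x m"
    unfolding rho_add(2,3) by (simp add: rho_alt)
  then show ?thesis by (simp add: rho_alt)
qed

lemma rho_swap: "rho y x m = - rho x y m"
  using rho_cancel[of x y m] by (simp add: eq_neg_iff_add_eq_0 add.commute)

text \<open>Provides the vector space structure on the direct sum and the linearity of
  \<open>fst\<close>.\<close>

sublocale GM: vector_space_prod scaleG scaleM
  by unfold_locales

abbreviation scaleE :: "'k \<Rightarrow> 'g \<times> 'm \<Rightarrow> 'g \<times> 'm"
  where "scaleE \<equiv> module_prod.scale scaleG scaleM"

end

section \<open>The abelian extension attached to a 2-cocycle\<close>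

locale rb_two_cocycle = rb_representation scaleG br lam T scaleM rho TM
  for scaleG :: "'k::field_char_0 \<Rightarrow> 'g::ab_group_add \<Rightarrow> 'g" and br lam T
    and scaleM :: "'k \<Rightarrow> 'm::ab_group_add \<Rightarrow> 'm" and rho TM +
  fixes psi :: "'g \<Rightarrow> 'g \<Rightarrow> 'g \<Rightarrow> 'm" and chi :: "'g \<Rightarrow> 'm"
  assumes cocycle: "(psi, chi) \<in> cocycles2 scaleG br lam T scaleM rho TM"
begin

lemma psi_add:
  "psi (x + x') y z = psi x y z + psi x' y z"
  "psi x (y + y') z = psi x y z + psi x y' z"
  "psi x y (z + z') = psi x y z + psi x y z'"
  and psi_scale:
  "psi (scaleG c x) y z = scaleM c (psi x y z)"
  "psi x (scaleG c y) z = scaleM c (psi x y z)"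
  "psi x y (scaleG c z) = scaleM c (psi x y z)"
  and psi_alt: "psi x x y = 0" "psi x y x = 0" "psi x y y = 0"
  using cocycle
  by (simp_all add: cocycles2_def cochains2_def alternating_trilinear_def Vector_Spaces.linear_iff)

lemma chi_add: "chi (x + y) = chi x + chi y"
  and chi_scale: "chi (scaleG c x) = scaleM c (chi x)"
  using cocycle by (simp_all add: cocycles2_def cochains2_def Vector_Spaces.linear_iff)

text \<open>The first component of the cocycle condition, with signs moved across so that it reads
  as the \<open>M\<close>-component of the fundamental identity of \<open>brE\<close> at the
  elements \<open>(xi, 0)\<close>.\<close>

lemma psi_fundamental_identity:
  "psi x1 x2 (br x3 x4 x5) + rho x1 x2 (psi x3 x4 x5) =
     psi (br x1 x2 x3) x4 x5 + psi x3 (br x1 x2 x4) x5 + psi x3 x4 (br x1 x2 x5)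
     + rho x4 x5 (psi x1 x2 x3) + rho x5 x3 (psi x1 x2 x4) + rho x3 x4 (psi x1 x2 x5)"
proof -
  have "delta2 br rho psi = 0"
    using cocycle by (simp add: cocycles2_def d2_def zero_prod_def)
  then have "delta2 br rho psi x1 x2 x3 x4 x5 = 0" by simp
  then show ?thesis by (simp add: delta2_def algebra_simps)
qed

text \<open>The second component of the cocycle condition, arranged as the
  \<open>M\<close>-component of the Rota-Baxter identity of \<open>TE\<close> at
  \<open>(x, 0)\<close>, \<open>(y, 0)\<close>, \<open>(z, 0)\<close>.\<close>

lemma psi_chi_rota_baxter:
  "rho (T x) (T y) (chi z) + rho (T y) (T z) (chi x) + rho (T z) (T x) (chi y)
     + psi (T x) (T y) (T z) =
   chi (rb_bracket scaleG br lam T x y z)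
     + TM (rho (T x) y (chi z) + rho x (T y) (chi z) + scaleM lam (rho x y (chi z)))
     + TM (rho (T y) z (chi x) + rho y (T z) (chi x) + scaleM lam (rho y z (chi x)))
     + TM (rho (T z) x (chi y) + rho z (T x) (chi y) + scaleM lam (rho z x (chi y)))
     + TM (psi (T x) (T y) z + psi (T x) y (T z) + psi x (T y) (T z)
         + scaleM lam (psi (T x) y z) + scaleM lam (psi x (T y) z) + scaleM lam (psi x y (T z))
         + scaleM (lam\<^sup>2) (psi x y z))"
proof -
  have "- partial1 scaleG br lam T scaleM rho TM chi - Phi2 lam T scaleM TM psi = 0"
    using cocycle by (simp add: cocycles2_def d2_def zero_prod_def)
  then have "(- partial1 scaleG br lam T scaleM rho TM chi - Phi2 lam T scaleM TM psi) x y z = 0"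
    by simp
  then show ?thesis
    by (simp add: partial1_def Phi2_def rho_T_def algebra_simps)
qed

abbreviation brE :: "'g \<times> 'm \<Rightarrow> 'g \<times> 'm \<Rightarrow> 'g \<times> 'm \<Rightarrow> 'g \<times> 'm"
  where "brE \<equiv> bracket_psi br rho psi"

abbreviation TE :: "'g \<times> 'm \<Rightarrow> 'g \<times> 'm"
  where "TE \<equiv> T_chi T TM chi"

lemma brE_Pair:
  "brE (x, m) (y, n) (z, q) = (br x y z, rho x y q + rho z x n + rho y z m + psi x y z)"
  by (simp add: bracket_psi_def)

lemma TE_Pair: "TE (x, m) = (T x, chi x + TM m)"
  by (simp add: T_chi_def)

text \<open>With two equal arguments, one \<open>rho\<close> term and the \<open>psi\<close> term
  vanish by alternation; the other two \<open>rho\<close> terms differ by a swap and fall to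
  \<open>rho_cancel\<close>.\<close>

lemma brE_alternating: "alternating_trilinear scaleE scaleE brE"
  unfolding alternating_trilinear_def Vector_Spaces.linear_iff
  by (auto simp: GM.p.vector_space_axioms brE_Pair GM.scale_prod br_add br_scale br_alt
      rho_add rho_scale rho_alt psi_add psi_scale psi_alt M.scale_right_distrib
      rho_cancel zero_prod_def ac_simps)

lemma brE_fundamental_identity:
  "brE u1 u2 (brE u3 u4 u5) =
     brE (brE u1 u2 u3) u4 u5 + brE u3 (brE u1 u2 u4) u5 + brE u3 u4 (brE u1 u2 u5)"
proof -
  obtain x1 m1 x2 m2 x3 m3 x4 m4 x5 m5
    where u: "u1 = (x1, m1)" "u2 = (x2, m2)" "u3 = (x3, m3)" "u4 = (x4, m4)" "u5 = (x5, m5)"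
    by (metis surj_pair)
  \<comment> \<open>The \<open>M\<close>-component is compared term by term in \<open>m1\<close>,
    ..., \<open>m5\<close>. The terms in \<open>m3\<close>, \<open>m4\<close>, \<open>m5\<close> are
    instances of \<open>rho_rho\<close>; those in \<open>m1\<close> and \<open>m2\<close> come from
    \<open>rho_br\<close>, rewritten in the cyclic order that \<open>brE\<close> produces.\<close>
  have 1: "rho x2 (br x3 x4 x5) m1 =
      rho x4 x5 (rho x2 x3 m1) + rho x5 x3 (rho x2 x4 m1) + rho x3 x4 (rho x2 x5 m1)"
    using rho_br[of x2 x3 x4 x5 m1] by (simp add: rho_swap[of x3 x5])
  \<comment> \<open>In the second slot \<open>brE\<close> has \<open>rho z x\<close>, so
    \<open>rho_br\<close> is negated and the pairs containing \<open>x1\<close> are swapped.\<close>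
  have 2: "rho (br x3 x4 x5) x1 m2 =
      rho x4 x5 (rho x3 x1 m2) + rho x5 x3 (rho x4 x1 m2) + rho x3 x4 (rho x5 x1 m2)"
    using arg_cong[OF rho_br[of x1 x3 x4 x5 m2], of uminus]
    by (simp add: rho_swap[of x3 x5] rho_swap[of x1] rho_uminus)
  show ?thesis
    unfolding u brE_Pair
    using psi_fundamental_identity[of x1 x2 x3 x4 x5] fundamental_identity[of x1 x2 x3 x4 x5]
      rho_rho[of x1 x2 x4 x5 m3] rho_rho[of x1 x2 x5 x3 m4] rho_rho[of x1 x2 x3 x4 m5] 1 2
    by (simp add: rho_add algebra_simps)
qed

lemma brE_rota_baxter: "brE (TE u) (TE v) (TE w) = TE (rb_bracket scaleE brE lam TE u v w)"
proof -
  obtain x m y n z q where u: "u = (x, m)" "v = (y, n)" "w = (z, q)"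
    by (metis surj_pair)
  show ?thesis
    unfolding u TE_Pair brE_Pair rb_bracket_def
    \<comment> \<open>The terms in \<open>q\<close>, \<open>m\<close>, \<open>n\<close> are
      \<open>rho_rota_baxter\<close> at the three cyclic pairs; the terms free of them are
      \<open>psi_chi_rota_baxter\<close>.\<close>
    using psi_chi_rota_baxter[of x y z] rota_baxter[of x y z]
      rho_rota_baxter[of x y q] rho_rota_baxter[of y z m] rho_rota_baxter[of z x n]
    by (simp add: TE_Pair brE_Pair GM.scale_prod rb_bracket_def rho_add M.scale_right_distrib
        TM_add TM_scale chi_add algebra_simps)
qed

lemma TE_linear: "Vector_Spaces.linear scaleE scaleE TE"
  unfolding Vector_Spaces.linear_iff
  by (auto simp: GM.p.vector_space_axioms TE_Pair GM.scale_prod T_add T_scale TM_add TM_scale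
      chi_add chi_scale M.scale_right_distrib ac_simps)

lemma rb_three_lie_algebra_extension: "rb_three_lie_algebra scaleE brE lam TE"
  by (intro rb_three_lie_algebra.intro three_lie_algebra.intro three_lie_algebra_axioms.intro
      rb_three_lie_algebra_axioms.intro GM.p.vector_space_axioms brE_alternating
      brE_fundamental_identity TE_linear brE_rota_baxter)

lemma extension_abelian:
  "abelian_extension lam scaleG br T scaleM TM scaleE brE TE (\<lambda>m. (0, m)) fst"
proof -
  \<comment> \<open>Elements of \<open>M\<close> sit in the sum as \<open>(0, m)\<close>. Two of
    them in a bracket put a zero into an argument of every \<open>rho\<close> and two equal zeros
    into \<open>br\<close> and \<open>psi\<close>, so everything vanishes.\<close>
  have zero: "T 0 = 0" "TM 0 = 0" "chi 0 = 0" "br x 0 0 = 0" "br 0 0 0 = 0"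
    "psi x 0 0 = 0" "psi 0 0 0 = 0" "rho x 0 m = 0" "rho 0 x m = 0" for x m
    using T_add[of 0 0] TM_add[of 0 0] chi_add[of 0 0] rho_add(2)[of 0 0 x m]
      rho_add(3)[of x 0 0 m] by (simp_all add: br_alt psi_alt)
  have incl: "rb_morphism lam scaleM (\<lambda>_ _ _. 0) TM scaleE brE TE (\<lambda>m. (0, m))"
    unfolding rb_morphism_def Vector_Spaces.linear_iff
    by (auto simp: rb_three_lie_algebra_zero_bracket[OF TM_linear] rb_three_lie_algebra_extension
        M.vector_space_axioms GM.p.vector_space_axioms GM.scale_prod brE_Pair TE_Pair zero
        zero_prod_def)
  have proj: "rb_morphism lam scaleE brE TE scaleG br T fst"
    unfolding rb_morphism_def
    by (auto simp: rb_three_lie_algebra_extension rb_three_lie_algebra_axioms GM.linear_fst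
        brE_Pair TE_Pair)
  have "brE u (0, m) (0, n) = 0" for u m n
    by (cases u) (simp add: brE_Pair zero zero_prod_def)
  then show ?thesis
    unfolding abelian_extension_def
    using incl proj by (auto simp: inj_on_def surj_def)
qed

end

section \<open>Isomorphism of the extensions given by cohomologous cocycles\<close>

theorem proposition5p8:
  fixes lam :: "'k::field_char_0"
    and scaleG :: "'k \<Rightarrow> 'g::ab_group_add \<Rightarrow> 'g"
    and br :: "'g \<Rightarrow> 'g \<Rightarrow> 'g \<Rightarrow> 'g"
    and T :: "'g \<Rightarrow> 'g"
    and scaleM :: "'k \<Rightarrow> 'm::ab_group_add \<Rightarrow> 'm"
    and rho :: "'g \<Rightarrow> 'g \<Rightarrow> 'm \<Rightarrow> 'm"
    and TM :: "'m \<Rightarrow> 'm"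
    and psi1 psi2 :: "'g \<Rightarrow> 'g \<Rightarrow> 'g \<Rightarrow> 'm"
    and chi1 chi2 :: "'g \<Rightarrow> 'm"
  assumes "rb_representation scaleG br lam T scaleM rho TM"
    and "(psi1, chi1) \<in> cocycles2 scaleG br lam T scaleM rho TM"
    and "(psi2, chi2) \<in> cocycles2 scaleG br lam T scaleM rho TM"
    and "cohomologous2 scaleG br T scaleM rho TM (psi1, chi1) (psi2, chi2)"
  shows "abelian_extension lam scaleG br T scaleM TM
           (module_prod.scale scaleG scaleM) (bracket_psi br rho psi1) (T_chi T TM chi1)
           (\<lambda>m. (0, m)) fst
    \<and> abelian_extension lam scaleG br T scaleM TM
           (module_prod.scale scaleG scaleM) (bracket_psi br rho psi2) (T_chi T TM chi2)
           (\<lambda>m. (0, m)) fst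
    \<and> isomorphic_extensions lam
           (module_prod.scale scaleG scaleM) (bracket_psi br rho psi1) (T_chi T TM chi1)
           (\<lambda>m. (0, m)) fst
           (module_prod.scale scaleG scaleM) (bracket_psi br rho psi2) (T_chi T TM chi2)
           (\<lambda>m. (0, m)) fst"
proof -
  interpret rb_representation scaleG br lam T scaleM rho TM by fact
  interpret c1: rb_two_cocycle scaleG br lam T scaleM rho TM psi1 chi1
    by unfold_locales fact
  interpret c2: rb_two_cocycle scaleG br lam T scaleM rho TM psi2 chi2
    by unfold_locales fact
  obtain f where f: "Vector_Spaces.linear scaleG scaleM f"
    and d: "psi1 - psi2 = delta1 br rho f" "chi1 - chi2 = - Phi1 T TM f"
    using assms(4)
    by (auto simp: cohomologous2_def cochains1_def d1_def partial0_def fun_eq_iff)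
  have f_add: "f (x + y) = f x + f y" and f_scale: "f (scaleG c x) = scaleM c (f x)" for x y c
    using f by (simp_all add: Vector_Spaces.linear_iff)
  \<comment> \<open>After expanding both sides of the bracket compatibility, the terms in the
    \<open>M\<close>-coordinates agree and this identity is what remains.\<close>
  have psi: "psi1 x y z + f (br x y z) =
      psi2 x y z + rho x y (f z) + rho y z (f x) + rho z x (f y)" for x y z
    using fun_cong[OF fun_cong[OF fun_cong[OF d(1)]], of x y z]
    by (simp add: delta1_def algebra_simps)
  have chi: "chi1 x + f (T x) = chi2 x + TM (f x)" for x
    using fun_cong[OF d(2), of x] by (simp add: Phi1_def algebra_simps)
  define zeta where "zeta = (\<lambda>(x, m). (x, m + f x))"
  have zeta_Pair: "zeta (x, m) = (x, m + f x)" for x m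
    by (simp add: zeta_def)
  have "Vector_Spaces.linear scaleE scaleE zeta"
    unfolding Vector_Spaces.linear_iff
    by (auto simp: GM.p.vector_space_axioms zeta_Pair GM.scale_prod f_add f_scale
        M.scale_right_distrib ac_simps)
  moreover have "zeta (c1.brE u v w) = c2.brE (zeta u) (zeta v) (zeta w)" for u v w
    using psi
    by (cases u; cases v; cases w) (simp add: zeta_Pair c1.brE_Pair c2.brE_Pair rho_add algebra_simps)
  moreover have "zeta \<circ> c1.TE = c2.TE \<circ> zeta"
    using chi by (auto simp: fun_eq_iff zeta_Pair c1.TE_Pair c2.TE_Pair TM_add algebra_simps)
  moreover have "bij zeta"
    \<comment> \<open>The inverse shear subtracts \<open>f x\<close>.\<close>
    by (rule o_bij[of "\<lambda>(x, m). (x, m - f x)"]) (auto simp: zeta_def)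
  moreover have "zeta \<circ> (\<lambda>m. (0, m)) = (\<lambda>m. (0, m))" and "fst \<circ> zeta = fst"
    \<comment> \<open>Additivity at \<open>0\<close> gives \<open>f 0 = 0\<close>, so
      \<open>zeta\<close> fixes the copy of \<open>M\<close>.\<close>
    using f_add[of 0 0] by (auto simp: zeta_Pair)
  ultimately have "isomorphic_extensions lam scaleE c1.brE c1.TE (\<lambda>m. (0, m)) fst
      scaleE c2.brE c2.TE (\<lambda>m. (0, m)) fst"
    unfolding isomorphic_extensions_def rb_morphism_def
    using c1.rb_three_lie_algebra_extension c2.rb_three_lie_algebra_extension by blast
  then show ?thesis
    using c1.extension_abelian c2.extension_abelian by blast
qed

end
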